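(* Let $G$ be a connected graph of order $n$ with maximum degree $\Delta$ and second maximum degree $\Delta'$. Then $$\rho^S(G)\ge\sqrt{(3n-2\Delta-3)(3n-2\Delta'-3)},$$ with equality if and only if $G$ is regular and has diameter at most $2$.
   Context: The distance Seidel matrix of a connected graph $G$ is $\mathcal{D}^S(G)=J-I-2\mathcal{D}(G)$, where $\mathcal{D}(G)$ is the distance matrix and $J$ the all-ones matrix; $\rho^S(G)=\max_i|\partial_i^S|$ over its eigenvalues (equivalently the largest eigenvalue of $-\mathcal{D}^S(G)$). The second maximum degree $\Delta'$ is the second entry of the degree sequence written in non-increasing order (it may equal $\Delta$). *)

theory Defs
  imports
    "Graph_Theory.Graph_Theory"
    "Jordan_Normal_Form.Spectral_Radius"
begin

text \<open>
  A finite simple undirected graph is a \<open>pre_digraph\<close> satisfying the locale predicate \<open>graph\<close>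
  (finite, loop-free, without parallel arcs, symmetric): each edge is a pair of opposite arcs.
  The degree of a vertex, i.e. its number of neighbours, is therefore its \<open>out_degree\<close>.
\<close>

text \<open>Nonincreasing; entry 0 is the maximum degree and entry 1 the second maximum degree.\<close>
definition degree_sequence :: "('a, 'b) pre_digraph \<Rightarrow> nat list" where
  "degree_sequence G =
     rev (sorted_list_of_multiset (image_mset (out_degree G) (mset_set (verts G))))"

definition max_degree :: "('a, 'b) pre_digraph \<Rightarrow> nat" where
  "max_degree G = Max (out_degree G ` verts G)"

text \<open>Meaningful only for graphs with at least two vertices; may coincide with \<open>max_degree\<close>.\<close>
definition second_max_degree :: "('a, 'b) pre_digraph \<Rightarrow> nat" where
  "second_max_degree G = degree_sequence G ! 1"

definition regular_graph :: "('a, 'b) pre_digraph \<Rightarrow> bool" where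
  "regular_graph G \<longleftrightarrow> (\<exists>r. \<forall>v \<in> verts G. out_degree G v = r)"

text \<open>
  \<open>wf_digraph.\<mu>\<close> is the infimum of the walk costs; with unit arc costs it is the length of a
  shortest walk. It is finite between vertices of a connected graph.
\<close>
definition graph_dist :: "('a, 'b) pre_digraph \<Rightarrow> 'a \<Rightarrow> 'a \<Rightarrow> real" where
  "graph_dist G u v = real_of_ereal (wf_digraph.\<mu> G (\<lambda>_. 1) u v)"

definition graph_diameter :: "('a, 'b) pre_digraph \<Rightarrow> real" where
  "graph_diameter G = Max {graph_dist G u v | u v. u \<in> verts G \<and> v \<in> verts G}"

text \<open>
  The matrices depend on an ordering \<open>vs\<close> of the vertices, a duplicate-free list of all of them.
  A different ordering permutes rows and columns simultaneously.
\<close>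
definition distance_matrix :: "('a, 'b) pre_digraph \<Rightarrow> 'a list \<Rightarrow> real mat" where
  "distance_matrix G vs =
     mat (length vs) (length vs) (\<lambda>(i, j). graph_dist G (vs ! i) (vs ! j))"

definition all_ones_mat :: "nat \<Rightarrow> real mat" where
  "all_ones_mat n = mat n n (\<lambda>_. 1)"

definition distance_seidel_matrix :: "('a, 'b) pre_digraph \<Rightarrow> 'a list \<Rightarrow> real mat" where
  "distance_seidel_matrix G vs =
     all_ones_mat (length vs) - 1\<^sub>m (length vs) - 2 \<cdot>\<^sub>m distance_matrix G vs"

text \<open>
  \<open>spectral_radius\<close> is the maximum of the absolute values of the complex eigenvalues; those of
  this real symmetric matrix are all real.
\<close>
definition distance_seidel_radius :: "('a, 'b) pre_digraph \<Rightarrow> 'a list \<Rightarrow> real" where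
  "distance_seidel_radius G vs =
     spectral_radius (map_mat complex_of_real (distance_seidel_matrix G vs))"

end

(*
  For a real symmetric matrix the spectral radius is at least the mean of the row sums in absolute
  value. The negated Seidel matrix has row sums 3n - 3 - 2 deg(u) plus a nonnegative excess that
  vanishes iff no vertex is farther than 2 from u. With a = 3n - 2 \<Delta> - 3 and
  b = 3n - 2 \<Delta>' - 3 the mean is at least (a + (n - 1) b) / n \<ge> (a + b) / 2 \<ge> sqrt (a b), because
  a \<le> b and n \<ge> 2. Equality forces a = b and all row sums equal to a. Conversely, the spectral
  radius is at most the largest absolute row sum.
*)
theory Submission
  imports
    Defs
    "HOL-Analysis.Convex"
begin

subsection \<open>Bounds for the spectral radius\<close>

lemma eigenvalue_smult_mat:
  fixes A :: "'a :: field mat"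
  assumes A: "A \<in> carrier_mat n n" and k: "k \<noteq> 0" and ev: "eigenvalue (k \<cdot>\<^sub>m A) e"
  shows "eigenvalue A (e / k)"
proof -
  from ev A obtain v where v: "v \<in> carrier_vec n" "v \<noteq> 0\<^sub>v n"
    and eq: "(k \<cdot>\<^sub>m A) *\<^sub>v v = e \<cdot>\<^sub>v v"
    unfolding eigenvalue_def eigenvector_def by auto
  have "A *\<^sub>v v = (e / k) \<cdot>\<^sub>v v"
  proof (rule eq_vecI)
    fix i assume "i < dim_vec ((e / k) \<cdot>\<^sub>v v)"
    with v have i: "i < n" by simp
    have "k * (row A i \<bullet> v) = ((k \<cdot>\<^sub>m A) *\<^sub>v v) $ i"
      using A v i by (simp add: scalar_prod_def sum_distrib_left mult.assoc)
    also have "\<dots> = e * v $ i" using eq v i by simp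
    finally show "(A *\<^sub>v v) $ i = ((e / k) \<cdot>\<^sub>v v) $ i"
      using A v i k by (simp add: field_simps)
  qed (use A v in auto)
  thus ?thesis using A v unfolding eigenvalue_def eigenvector_def by auto
qed

text \<open>Allows a matrix to be rescaled to spectral radius below 1.\<close>

lemma spectral_radius_smult_le:
  fixes A :: "complex mat"
  assumes A: "A \<in> carrier_mat n n" and n: "n > 0" and k: "k \<noteq> 0"
  shows "spectral_radius (k \<cdot>\<^sub>m A) \<le> norm k * spectral_radius A"
proof -
  have kA: "k \<cdot>\<^sub>m A \<in> carrier_mat n n" using A by simp
  obtain e where e: "eigenvalue (k \<cdot>\<^sub>m A) e" "spectral_radius (k \<cdot>\<^sub>m A) = norm e"
    using spectral_radius_mem_max(1)[OF kA n] unfolding spectrum_def by auto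
  have "norm (e / k) \<le> spectral_radius A"
    using spectral_radius_mem_max(2)[OF A n] eigenvalue_smult_mat[OF A k e(1)]
    unfolding spectrum_def by auto
  thus ?thesis using e(2) k by (simp add: norm_divide field_simps)
qed

text \<open>At a coordinate where an eigenvector has largest modulus \<open>m\<close>, the
  eigenvalue equation bounds \<open>norm e * m\<close> by the absolute row sum times
  \<open>m\<close>. This gives the upper bound in the regular case.\<close>

lemma spectral_radius_le_row_sums:
  fixes A :: "complex mat"
  assumes A: "A \<in> carrier_mat n n" and n: "n > 0"
    and row: "\<And>i. i < n \<Longrightarrow> (\<Sum>j<n. norm (A $$ (i, j))) \<le> c"
  shows "spectral_radius A \<le> c"
proof -
  obtain e where e: "eigenvalue A e" "spectral_radius A = norm e"
    using spectral_radius_mem_max(1)[OF A n] unfolding spectrum_def by auto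
  then obtain v where v: "v \<in> carrier_vec n" "v \<noteq> 0\<^sub>v n" and eq: "A *\<^sub>v v = e \<cdot>\<^sub>v v"
    using A unfolding eigenvalue_def eigenvector_def by auto
  define m where "m = Max ((\<lambda>i. norm (v $ i)) ` {..<n})"
  have "m \<in> (\<lambda>i. norm (v $ i)) ` {..<n}"
    unfolding m_def using n by (intro Max_in) auto
  then obtain i where i: "i < n" "m = norm (v $ i)" by auto
  have le: "norm (v $ j) \<le> m" if "j < n" for j
    unfolding m_def using that by (intro Max_ge) auto
  have mpos: "m > 0"
  proof (rule ccontr)
    assume "\<not> m > 0"
    hence "v $ j = 0" if "j < n" for j using le[OF that] by (smt (verit) norm_le_zero_iff)
    hence "v = 0\<^sub>v n" using v by (intro eq_vecI) auto
    thus False using v by simp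
  qed
  have "norm e * m = norm ((A *\<^sub>v v) $ i)" using eq v i by (simp add: norm_mult)
  also have "\<dots> = norm (\<Sum>j<n. A $$ (i, j) * v $ j)"
    using A v i by (simp add: scalar_prod_def lessThan_atLeast0)
  also have "\<dots> \<le> (\<Sum>j<n. norm (A $$ (i, j)) * m)"
    by (rule sum_norm_le) (auto simp: norm_mult intro!: mult_left_mono le)
  also have "\<dots> \<le> c * m"
    unfolding sum_distrib_right[symmetric] using row[OF i(1)] mpos by (intro mult_right_mono) auto
  finally show ?thesis using e mpos by simp
qed

section \<open>Entry sums of powers of a symmetric matrix\<close>

lemma pow_mat_add:
  fixes A :: "'a :: semiring_1 mat"
  assumes A: "A \<in> carrier_mat n n"
  shows "A ^\<^sub>m (k + l) = A ^\<^sub>m k * A ^\<^sub>m l"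
proof (induction l)
  case (Suc l)
  have "A ^\<^sub>m i \<in> carrier_mat n n" for i using A by (rule pow_carrier_mat)
  from assoc_mult_mat[OF this[of k] this[of l] A] show ?case using Suc by simp
qed (use A in simp)

lemma symmetric_mat_pow_transpose:
  fixes A :: "'a :: comm_semiring_1 mat"
  assumes A: "A \<in> carrier_mat n n" and sym: "transpose_mat A = A"
  shows "transpose_mat (A ^\<^sub>m k) = A ^\<^sub>m k"
proof (induction k)
  case 0
  show ?case using A by simp
next
  case (Suc k)
  have P: "A ^\<^sub>m k \<in> carrier_mat n n" using A by (rule pow_carrier_mat)
  \<comment> \<open>Powers grow by multiplication on the right, while transposition moves the new
    factor to the left; the factor commutes with the power.\<close>
  have "A * A ^\<^sub>m k = A ^\<^sub>m k * A"
    using pow_mat_add[OF A, of 1 k] A by simp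
  thus ?case using transpose_mult[OF P A] Suc sym by simp
qed

text \<open>For an n by n matrix this is the quadratic form at the all-ones vector; dividing by n
  gives its Rayleigh quotient.\<close>

definition entry_sum :: "'a :: comm_monoid_add mat \<Rightarrow> 'a" where
  "entry_sum A = (\<Sum>i<dim_row A. \<Sum>j<dim_col A. A $$ (i, j))"

text \<open>By symmetry the entry sum of \<open>A * A\<close> is the sum of the squared row sums of
  \<open>A\<close>, so this is Cauchy-Schwarz for the vector of row sums.\<close>

lemma entry_sum_sq:
  fixes A :: "real mat"
  assumes A: "A \<in> carrier_mat n n" and sym: "transpose_mat A = A"
  shows "(entry_sum A)\<^sup>2 \<le> real n * entry_sum (A * A)"
proof -
  define r where "r i = (\<Sum>j<n. A $$ (i, j))" for i
  have s: "A $$ (i, j) = A $$ (j, i)" if "i < n" "j < n" for i j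
    using arg_cong[OF sym, of "\<lambda>M. M $$ (i, j)"] A that by simp
  have "entry_sum (A * A) = (\<Sum>i<n. \<Sum>j<n. \<Sum>l<n. A $$ (i, l) * A $$ (l, j))"
    using A by (simp add: entry_sum_def scalar_prod_def lessThan_atLeast0)
  also have "\<dots> = (\<Sum>i<n. \<Sum>l<n. \<Sum>j<n. A $$ (l, i) * A $$ (l, j))"
    by (rule sum.cong[OF refl], subst sum.swap) (auto intro!: sum.cong simp: s)
  also have "\<dots> = (\<Sum>l<n. \<Sum>i<n. \<Sum>j<n. A $$ (l, i) * A $$ (l, j))"
    by (rule sum.swap)
  also have "\<dots> = (\<Sum>l<n. (r l)\<^sup>2)"
    by (simp add: r_def power2_eq_square sum_product)
  finally have "entry_sum (A * A) = (\<Sum>l<n. (r l)\<^sup>2)" .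
  moreover have "entry_sum A = (\<Sum>l<n. r l)"
    using A by (simp add: entry_sum_def r_def)
  moreover have "(\<Sum>l<n. r l)\<^sup>2 \<le> real n * (\<Sum>l<n. (r l)\<^sup>2)"
    using sum_squared_le_sum_of_squares[of r "{..<n}"] by (simp add: mult.commute)
  ultimately show ?thesis by simp
qed

text \<open>Each application of \<open>entry_sum_sq\<close> to a symmetric power doubles the
  exponent, hence the exponents \<open>2 ^ k\<close>.\<close>

lemma entry_sum_pow:
  fixes A :: "real mat"
  assumes A: "A \<in> carrier_mat n n" and sym: "transpose_mat A = A" and n: "n > 0"
  shows "(\<bar>entry_sum A\<bar> / n) ^ (2 ^ k) \<le> \<bar>entry_sum (A ^\<^sub>m (2 ^ k))\<bar> / n"
proof (induction k)
  case 0
  show ?case using A by simp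
next
  case (Suc k)
  let ?P = "A ^\<^sub>m (2 ^ k)"
  have P: "?P \<in> carrier_mat n n" using A by (rule pow_carrier_mat)
  have PP: "?P * ?P = A ^\<^sub>m (2 ^ Suc k)"
    using pow_mat_add[OF A, of "2 ^ k" "2 ^ k"] by (simp add: mult_2)
  have "(\<bar>entry_sum A\<bar> / n) ^ (2 ^ Suc k) = ((\<bar>entry_sum A\<bar> / n) ^ (2 ^ k))\<^sup>2"
    by (simp add: power_mult[symmetric] mult.commute)
  also have "\<dots> \<le> (\<bar>entry_sum ?P\<bar> / n)\<^sup>2"
    using Suc by (intro power_mono) auto
  also have "\<dots> = (entry_sum ?P)\<^sup>2 / n / n" by (simp add: power2_eq_square)
  also have "\<dots> \<le> entry_sum (?P * ?P) / n"
    using entry_sum_sq[OF P symmetric_mat_pow_transpose[OF A sym]] n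
    by (intro divide_right_mono) (auto simp: field_simps)
  also have "\<dots> \<le> \<bar>entry_sum (A ^\<^sub>m (2 ^ Suc k))\<bar> / n"
    unfolding PP by (intro divide_right_mono) auto
  finally show ?case .
qed

text \<open>
  If the inequality failed, a scaled copy of the matrix would have bounded powers, although by
  Cauchy-Schwarz the entry sums of its \<open>2 ^ k\<close>-th powers grow without bound.
\<close>
lemma entry_sum_le_spectral_radius:
  fixes A :: "real mat"
  assumes A: "A \<in> carrier_mat n n" and sym: "transpose_mat A = A" and n: "n > 0"
  shows "\<bar>entry_sum A\<bar> \<le> real n * spectral_radius (map_mat complex_of_real A)"
proof (rule ccontr)
  let ?c = "map_mat complex_of_real"
  define \<rho> where "\<rho> = spectral_radius (?c A)"
  have cA: "?c A \<in> carrier_mat n n" using A by simp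
  have "\<rho> \<ge> 0" unfolding \<rho>_def using spectral_radius_mem_max(1)[OF cA n] by auto
  assume "\<not> ?thesis"
  hence "\<rho> < \<bar>entry_sum A\<bar> / n" using n by (simp add: \<rho>_def field_simps)
  \<comment> \<open>Dividing by \<open>b\<close> puts the spectral radius below 1 and keeps the
    normalised entry sum above 1.\<close>
  then obtain b where b: "\<rho> < b" "b < \<bar>entry_sum A\<bar> / n" using dense by blast
  have bpos: "b > 0" using b \<open>\<rho> \<ge> 0\<close> by simp
  define B where "B = (1 / b) \<cdot>\<^sub>m A"
  have B: "B \<in> carrier_mat n n" unfolding B_def using A by simp
  have symB: "transpose_mat B = B"
  proof (rule eq_matI)
    fix i j assume "i < dim_row B" "j < dim_col B"
    with arg_cong[OF sym, of "\<lambda>M. M $$ (i, j)"] A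
    show "transpose_mat B $$ (i, j) = B $$ (i, j)" by (simp add: B_def)
  qed (use B in auto)
  have "?c B = complex_of_real (1 / b) \<cdot>\<^sub>m ?c A"
    unfolding B_def using A by (intro eq_matI) auto
  hence "spectral_radius (?c B) \<le> norm (complex_of_real (1 / b)) * \<rho>"
    using spectral_radius_smult_le[OF cA n] bpos unfolding \<rho>_def by simp
  also have "\<dots> < 1" using b bpos by (simp add: field_simps norm_divide)
  \<comment> \<open>One constant bounds all entries of all powers.\<close>
  finally obtain c where c: "norm_bound (?c B ^\<^sub>m k) c" for k
    using spectral_radius_jnf_norm_bound_less_1_upper_triangular[of "?c B" n] B by auto
  have bound: "\<bar>entry_sum (B ^\<^sub>m k)\<bar> / n \<le> n * c" for k
  proof -
    have P: "B ^\<^sub>m k \<in> carrier_mat n n" using B by (rule pow_carrier_mat)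
    have "?c B ^\<^sub>m k = ?c (B ^\<^sub>m k)"
      by (rule of_real_hom.mat_hom_pow[OF B, symmetric])
    hence "\<bar>(B ^\<^sub>m k) $$ (i, j)\<bar> \<le> c" if "i < n" "j < n" for i j
      using c[of k] P that unfolding norm_bound_def by (simp del: pow_mat_dim)
    hence "\<bar>entry_sum (B ^\<^sub>m k)\<bar> \<le> (\<Sum>i<n. \<Sum>j<n. c)"
      unfolding entry_sum_def carrier_matD[OF P]
      by (intro order_trans[OF sum_abs] sum_mono) auto
    thus ?thesis using n by (simp add: field_simps)
  qed
  define q where "q = \<bar>entry_sum B\<bar> / n"
  have q_eq: "q = (\<bar>entry_sum A\<bar> / n) / b"
    using A bpos by (simp add: q_def entry_sum_def B_def sum_divide_distrib[symmetric])
  have q: "q > 1" unfolding q_eq using b(2) bpos by (simp only: less_divide_eq_1_pos)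
  obtain k where "real n * c < q ^ k" using real_arch_pow[OF q] by blast
  \<comment> \<open>The growth estimate covers only exponents that are powers of two; since
    \<open>q > 1\<close>, passing from \<open>k\<close> to \<open>2 ^ k\<close> is harmless.\<close>
  also have "\<dots> \<le> q ^ (2 ^ k)" using q by (intro power_increasing) auto
  also have "\<dots> \<le> \<bar>entry_sum (B ^\<^sub>m (2 ^ k))\<bar> / n"
    unfolding q_def by (rule entry_sum_pow[OF B symB n])
  also have "\<dots> \<le> n * c" by (rule bound)
  finally show False by simp
qed

subsection \<open>Distances and degrees\<close>

lemma (in wf_digraph) awalk_cost_unit: "awalk_cost (\<lambda>_. 1) p = real (length p)"
  by (induction p) auto

lemma (in sym_digraph) awalk_reverse:
  assumes "awalk u p v"
  shows "\<exists>q. awalk v q u \<and> length q = length p"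
  using assms
proof (induction p arbitrary: u)
  case Nil
  thus ?case by (auto simp: awalk_Nil_iff)
next
  case (Cons e p)
  hence e: "e \<in> arcs G" "u = tail G e" and w: "awalk (head G e) p v"
    by (auto simp: awalk_Cons_iff)
  from Cons.IH[OF w] obtain q where q: "awalk v q (head G e)" "length q = length p" by blast
  from sym_arcs e obtain f where f: "f \<in> arcs G" "tail G f = head G e" "head G f = u"
    unfolding symmetric_conv by metis
  have "awalk v (q @ [f]) u"
    using q(1) arc_implies_awalk[OF f(1)] f by (auto intro: awalk_appendI)
  thus ?case using q(2) by (intro exI[of _ "q @ [f]"]) simp
qed

text \<open>Lengths are natural numbers, so the infimum is attained once some walk exists. Its value
  is then finite, and \<open>real_of_ereal\<close> does not fall back on its default 0.\<close>

lemma (in wf_digraph) graph_dist_awalk: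
  assumes "u \<rightarrow>\<^sup>* v"
  obtains p where "awalk u p v" "graph_dist G u v = length p"
    "\<And>q. awalk u q v \<Longrightarrow> length p \<le> length q"
proof -
  obtain p where p: "awalk u p v" and min: "\<And>q. awalk u q v \<Longrightarrow> length p \<le> length q"
    using assms exists_least_iff[of "\<lambda>k. \<exists>p. awalk u p v \<and> length p = k"]
    unfolding reachable_awalk by (metis not_le)
  have "\<mu> (\<lambda>_. 1) u v = ereal (length p)"
    unfolding \<mu>_def awalk_cost_unit
    by (rule antisym) (use p min in \<open>auto intro!: INF_lower INF_greatest\<close>)
  hence "graph_dist G u v = length p" unfolding graph_dist_def by simp
  with p min that show ?thesis by blast
qed

text \<open>Without parallel arcs, an arc out of \<open>u\<close> is determined by its head.\<close>

lemma (in graph) out_degree_eq_card_neighbours: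
  "out_degree G u = card {v \<in> verts G. (u, v) \<in> arcs_ends G}"
proof -
  have "inj_on (head G) (out_arcs G u)"
    by (rule inj_onI) (auto intro!: no_multi_arcs simp: arc_to_ends_def)
  moreover have "head G ` out_arcs G u = {v \<in> verts G. (u, v) \<in> arcs_ends G}"
    by (auto simp: arcs_ends_conv)
  ultimately show ?thesis unfolding out_degree_def by (metis card_image)
qed

section \<open>Truncated distances and row sums of the negated Seidel matrix\<close>

locale connected_graph = graph +
  assumes conn: "Digraph_Component.connected G"
begin

lemma reach: "u \<in> verts G \<Longrightarrow> v \<in> verts G \<Longrightarrow> u \<rightarrow>\<^sup>* v"
  using symmetric_connected_imp_strongly_connected[OF sym_arcs conn]
  by (auto simp: strongly_connected_def)

lemma graph_dist_commute:
  assumes "u \<in> verts G" "v \<in> verts G"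
  shows "graph_dist G u v = graph_dist G v u"
proof -
  obtain p where p: "awalk u p v" "graph_dist G u v = length p"
    "\<And>q. awalk u q v \<Longrightarrow> length p \<le> length q"
    using graph_dist_awalk[OF reach[OF assms]] by blast
  obtain q where q: "awalk v q u" "graph_dist G v u = length q"
    "\<And>p. awalk v p u \<Longrightarrow> length q \<le> length p"
    using graph_dist_awalk[OF reach[OF assms(2,1)]] by blast
  show ?thesis using p q awalk_reverse by (metis le_antisym)
qed

text \<open>On vertices this is the minimum of 2 and the distance, expressed by adjacency alone so
  that its sums depend only on degrees.\<close>

definition truncated_dist :: "'a \<Rightarrow> 'a \<Rightarrow> real" where
  "truncated_dist u v = (if u = v then 0 else if (u, v) \<in> arcs_ends G then 1 else 2)"

lemma graph_dist_truncated:
  assumes "u \<in> verts G" "v \<in> verts G"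
  shows "truncated_dist u v \<le> graph_dist G u v"
    and "graph_dist G u v \<le> 2 \<longleftrightarrow> graph_dist G u v = truncated_dist u v"
proof -
  obtain p where p: "awalk u p v" "graph_dist G u v = length p"
    "\<And>q. awalk u q v \<Longrightarrow> length p \<le> length q"
    using graph_dist_awalk[OF reach[OF assms]] by blast
  \<comment> \<open>The shortest walk is compared with the empty walk and with single arcs.\<close>
  have 0: "length p = 0 \<longleftrightarrow> u = v"
    using p(1) p(3)[of "[]"] assms by (auto simp: awalk_Nil_iff)
  have 1: "length p \<le> 1" if "(u, v) \<in> arcs_ends G"
    using that p(3)[of "[e]" for e] arc_implies_awalk by (fastforce simp: arcs_ends_conv)
  have 2: "(u, v) \<in> arcs_ends G" if "length p = 1"
    using that p(1) by (cases p) (auto simp: awalk_simps arcs_ends_conv)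
  consider "u = v" "length p = 0" | "u \<noteq> v" "(u, v) \<in> arcs_ends G" "length p = 1"
    | "u \<noteq> v" "(u, v) \<notin> arcs_ends G" "length p \<ge> 2"
    using 0 1 2 by linarith
  thus "truncated_dist u v \<le> graph_dist G u v"
    and "graph_dist G u v \<le> 2 \<longleftrightarrow> graph_dist G u v = truncated_dist u v"
    unfolding p(2) truncated_dist_def by (cases; simp)+
qed

lemma sum_truncated_dist:
  assumes u: "u \<in> verts G"
  shows "(\<Sum>v\<in>verts G. truncated_dist u v) = 2 * real (card (verts G)) - 2 - out_degree G u"
proof -
  let ?V = "verts G" and ?N = "{v \<in> verts G. (u, v) \<in> arcs_ends G}"
  have noloop: "(u, u) \<notin> arcs_ends G" using no_loops by (auto simp: arcs_ends_conv)
  \<comment> \<open>As there are no loops, the two indicators are never both 1, which makes the case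
    distinction linear.\<close>
  have "(\<Sum>v\<in>?V. truncated_dist u v)
      = (\<Sum>v\<in>?V. 2 - 2 * of_bool (v = u) - of_bool ((u, v) \<in> arcs_ends G))"
    using noloop by (intro sum.cong) (auto simp: truncated_dist_def)
  also have "\<dots> = 2 * real (card ?V) - 2 * (\<Sum>v\<in>?V. of_bool (v = u))
      - (\<Sum>v\<in>?V. of_bool ((u, v) \<in> arcs_ends G))"
    by (simp add: sum_subtractf sum_distrib_left)
  also have "(\<Sum>v\<in>?V. of_bool (v = u) :: real) = 1"
    using u by (simp add: of_bool_def)
  also have "(\<Sum>v\<in>?V. of_bool ((u, v) \<in> arcs_ends G) :: real) = out_degree G u"
    unfolding out_degree_eq_card_neighbours by (simp add: of_bool_def sum.If_cases Int_def)
  finally show ?thesis by simp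
qed

lemma graph_diameter_le_iff:
  "graph_diameter G \<le> c \<longleftrightarrow> (\<forall>u\<in>verts G. \<forall>v\<in>verts G. graph_dist G u v \<le> c)"
proof -
  let ?S = "{graph_dist G u v | u v. u \<in> verts G \<and> v \<in> verts G}"
  have eq: "?S = case_prod (graph_dist G) ` (verts G \<times> verts G)" by auto
  have "verts G \<noteq> {}"
    using symmetric_connected_imp_strongly_connected[OF sym_arcs conn]
    by (auto simp: strongly_connected_def)
  hence "finite ?S" "?S \<noteq> {}" unfolding eq by auto
  thus ?thesis unfolding graph_diameter_def by (subst Max_le_iff) auto
qed

text \<open>The entry of 2D + I - J, the negated Seidel matrix, indexed by vertices. With this sign
  the entries are nonnegative, so row sums are absolute row sums.\<close>

definition seidel_weight :: "'a \<Rightarrow> 'a \<Rightarrow> real" where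
  "seidel_weight u v = 2 * graph_dist G u v - 1 + of_bool (u = v)"

lemma seidel_weight_nonneg:
  assumes "u \<in> verts G" "v \<in> verts G"
  shows "seidel_weight u v \<ge> 0"
  using graph_dist_truncated(1)[OF assms]
  by (auto simp: seidel_weight_def truncated_dist_def split: if_splits)

text \<open>Splitting each distance into its truncated part and an excess separates the degree of
  \<open>u\<close> from the contribution of vertices farther than 2.\<close>

lemma seidel_transmission:
  assumes u: "u \<in> verts G"
  shows "(\<Sum>v\<in>verts G. seidel_weight u v) = 3 * real (card (verts G)) - 3 - 2 * out_degree G u
           + 2 * (\<Sum>v\<in>verts G. graph_dist G u v - truncated_dist u v)"
proof -
  have "(\<Sum>v\<in>verts G. seidel_weight u v) = 2 * (\<Sum>v\<in>verts G. graph_dist G u v)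
      - card (verts G) + (\<Sum>v\<in>verts G. of_bool (u = v))"
    by (simp add: seidel_weight_def sum.distrib sum_subtractf sum_distrib_left)
  also have "(\<Sum>v\<in>verts G. of_bool (u = v) :: real) = 1"
    using u by (simp add: of_bool_def)
  finally show ?thesis using sum_truncated_dist[OF u] by (simp add: sum_subtractf)
qed

end

text \<open>In the sorted list the head is the maximum, and each of the other \<open>n - 1\<close>
  entries is at most entry 1, which exists because \<open>n \<ge> 2\<close>.\<close>

lemma degree_sequence_sum:
  assumes fin: "finite (verts G)" and n: "card (verts G) = n" "n \<ge> 2"
  shows "second_max_degree G \<le> max_degree G"
    and "(\<Sum>v\<in>verts G. out_degree G v) \<le> max_degree G + (n - 1) * second_max_degree G"
    and "second_max_degree G \<in> out_degree G ` verts G"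
proof -
  let ?M = "image_mset (out_degree G) (mset_set (verts G))"
  define ds where "ds = degree_sequence G"
  have ms: "mset ds = ?M" unfolding ds_def degree_sequence_def by simp
  have len: "length ds = n" using arg_cong[OF ms, of size] n by simp
  then obtain a b xs where ds: "ds = a # b # xs"
    using n by (metis One_nat_def Suc_1 Suc_le_length_iff)
  have "sorted (rev ds)" unfolding ds_def degree_sequence_def by simp
  hence sd: "b \<le> a" "\<forall>x\<in>set xs. x \<le> b" "\<forall>x\<in>set xs. x \<le> a"
    unfolding ds by (auto simp: sorted_append)
  have set: "set ds = out_degree G ` verts G"
    using arg_cong[OF ms, of set_mset] fin by simp
  have a: "max_degree G = a"
    unfolding max_degree_def set[symmetric] ds using sd by (intro Max_eqI) auto
  have b: "second_max_degree G = b"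
    unfolding second_max_degree_def ds_def[symmetric] ds by simp
  show "second_max_degree G \<le> max_degree G" using a b sd by simp
  show "second_max_degree G \<in> out_degree G ` verts G" using b set ds by auto
  have "(\<Sum>v\<in>verts G. out_degree G v) = sum_list ds"
    using arg_cong[OF ms, of sum_mset] by (simp add: sum_mset_sum_list sum_unfold_sum_mset)
  also have "sum_list xs \<le> length xs * b"
    using sd(2) by (induction xs) auto
  hence "sum_list ds \<le> a + (n - 1) * b"
    using len unfolding ds by auto
  finally show "(\<Sum>v\<in>verts G. out_degree G v) \<le> max_degree G + (n - 1) * second_max_degree G"
    using a b by simp
qed

section \<open>The lower bound and its equality case\<close>

theorem theorem4p3:
  fixes G :: "('a, 'b) pre_digraph" and vs :: "'a list" and n :: nat
  assumes "graph G"
    and "Digraph_Component.connected G"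
    and "card (verts G) = n" and "n \<ge> 2"
    and "distinct vs" and "set vs = verts G"
  shows "distance_seidel_radius G vs
           \<ge> sqrt ((3 * real n - 2 * real (max_degree G) - 3)
                  * (3 * real n - 2 * real (second_max_degree G) - 3))
       \<and> (distance_seidel_radius G vs
             = sqrt ((3 * real n - 2 * real (max_degree G) - 3)
                    * (3 * real n - 2 * real (second_max_degree G) - 3))
           \<longleftrightarrow> regular_graph G \<and> graph_diameter G \<le> 2)"
proof -
  interpret graph G by fact
  interpret connected_graph G by unfold_locales fact
  let ?V = "verts G" and ?\<rho> = "distance_seidel_radius G vs"
  define A where "A = distance_seidel_matrix G vs"
  define a where "a = 3 * real n - 2 * real (max_degree G) - 3"
  define b where "b = 3 * real n - 2 * real (second_max_degree G) - 3"
  define T where "T u = (\<Sum>v\<in>?V. seidel_weight u v)" for u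
  have n0: "n > 0" using assms by simp
  have len: "length vs = n" using assms by (metis distinct_card)
  have A: "A \<in> carrier_mat n n"
    unfolding A_def distance_seidel_matrix_def all_ones_mat_def distance_matrix_def len
    by (intro minus_carrier_mat smult_carrier_mat) simp
  \<comment> \<open>Transfers sums over matrix positions to sums over vertices.\<close>
  have bij: "bij_betw ((!) vs) {..<n} ?V"
    using bij_betw_nth[OF assms(5), of "{..<n}" ?V] assms(6) len by simp
  have vs: "vs ! i \<in> ?V" if "i < n" for i
    using nth_mem[of i vs] that unfolding len assms(6) .
  have ent: "A $$ (i, j) = - seidel_weight (vs ! i) (vs ! j)" if "i < n" "j < n" for i j
  proof -
    have "vs ! i = vs ! j \<longleftrightarrow> i = j"
      using that len assms(5) by (simp add: nth_eq_iff_index_eq)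
    thus ?thesis
      using that
      by (simp add: A_def distance_seidel_matrix_def all_ones_mat_def distance_matrix_def len
          seidel_weight_def of_bool_def)
  qed
  have row: "(\<Sum>j<n. seidel_weight (vs ! i) (vs ! j)) = T (vs ! i)" for i
    unfolding T_def by (rule sum.reindex_bij_betw[OF bij])
  have sym: "transpose_mat A = A"
  proof (rule eq_matI)
    fix i j assume ij: "i < dim_row A" "j < dim_col A"
    hence "graph_dist G (vs ! i) (vs ! j) = graph_dist G (vs ! j) (vs ! i)"
      using A vs by (intro graph_dist_commute) auto
    thus "transpose_mat A $$ (i, j) = A $$ (i, j)"
      using ij A by (simp add: ent seidel_weight_def eq_commute)
  qed (use A in auto)
  have "entry_sum A = - (\<Sum>i<n. \<Sum>j<n. seidel_weight (vs ! i) (vs ! j))"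
    using A by (simp add: entry_sum_def ent sum_negf)
  also have "\<dots> = - (\<Sum>u\<in>?V. T u)"
    unfolding row by (simp add: sum.reindex_bij_betw[OF bij, of T])
  \<comment> \<open>The absolute value in the spectral bound absorbs the minus sign.\<close>
  finally have ge: "(\<Sum>u\<in>?V. T u) \<le> n * ?\<rho>"
    using entry_sum_le_spectral_radius[OF A sym n0]
    unfolding distance_seidel_radius_def A_def[symmetric] by simp
  have T: "T u = 3 * real n - 3 - 2 * out_degree G u
      + 2 * (\<Sum>v\<in>?V. graph_dist G u v - truncated_dist u v)" if "u \<in> ?V" for u
    unfolding T_def using seidel_transmission[OF that] assms(3) by simp
  have excess: "(\<Sum>v\<in>?V. graph_dist G u v - truncated_dist u v) \<ge> 0" if "u \<in> ?V" for u
    using graph_dist_truncated(1)[OF that] by (intro sum_nonneg) auto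
  have deg_le: "out_degree G u \<le> max_degree G" if "u \<in> ?V" for u
    unfolding max_degree_def using that by (intro Max_ge) auto
  note degs = degree_sequence_sum[OF finite_verts assms(3,4)]
  have "max_degree G \<in> out_degree G ` ?V"
    unfolding max_degree_def using assms by (intro Max_in) auto
  then obtain w where w: "w \<in> ?V" "max_degree G = out_degree G w" by auto
  have "out_degree G w \<le> card (?V - {w})"
    unfolding out_degree_eq_card_neighbours using no_loops
    by (intro card_mono) (fastforce simp: arcs_ends_conv)+
  hence "max_degree G \<le> n - 1" using w assms by simp
  \<comment> \<open>In fact \<open>max_degree G \<le> n - 1\<close> gives
    \<open>a \<ge> n - 1\<close>.\<close>
  hence a0: "a \<ge> 0" unfolding a_def using assms(4) by linarith
  have ab: "a \<le> b" unfolding a_def b_def using degs(1) by simp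
  have Ta: "a \<le> T u" if "u \<in> ?V" for u
    using T[OF that] excess[OF that] deg_le[OF that] unfolding a_def by simp
  have "real (\<Sum>u\<in>?V. out_degree G u)
      \<le> real (max_degree G + (n - 1) * second_max_degree G)"
    using degs(2) by (rule of_nat_mono)
  hence "(\<Sum>u\<in>?V. real (out_degree G u))
      \<le> real (max_degree G) + (real n - 1) * real (second_max_degree G)"
    using n0 by (simp add: of_nat_diff)
  \<comment> \<open>One vertex is charged the maximum degree, contributing \<open>a\<close>, and the
    other \<open>n - 1\<close> the second maximum degree, contributing \<open>b\<close>
    each.\<close>
  hence "(\<Sum>u\<in>?V. 3 * real n - 3 - 2 * out_degree G u) \<ge> a + (real n - 1) * b"
    using assms(3) unfolding a_def b_def
    by (simp add: sum_subtractf sum_distrib_left[symmetric] algebra_simps)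
  moreover have "(\<Sum>u\<in>?V. 3 * real n - 3 - 2 * out_degree G u) \<le> (\<Sum>u\<in>?V. T u)"
    using T excess by (intro sum_mono) auto
  ultimately have sumT: "a + (real n - 1) * b \<le> (\<Sum>u\<in>?V. T u)" by simp
  \<comment> \<open>This is twice the gap between \<open>a + (n - 1) * b\<close> and
    \<open>n * ((a + b) / 2)\<close>.\<close>
  have "(real n - 2) * (b - a) \<ge> 0" using assms(4) ab by simp
  hence mean: "n * ((a + b) / 2) \<le> a + (real n - 1) * b" by (simp add: field_simps)
  have amgm: "sqrt (a * b) \<le> (a + b) / 2" using arith_geo_mean_sqrt a0 ab by simp
  have "n * sqrt (a * b) \<le> n * ?\<rho>"
    using ge sumT mean mult_left_mono[OF amgm, of "real n"] by simp
  hence lower: "sqrt (a * b) \<le> ?\<rho>" using n0 by simp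
  have "?\<rho> = sqrt (a * b) \<longleftrightarrow> regular_graph G \<and> graph_diameter G \<le> 2"
  proof
    assume eq: "?\<rho> = sqrt (a * b)"
    \<comment> \<open>Equality collapses the chain of estimates, so the arithmetic and geometric
      means of \<open>a\<close> and \<open>b\<close> agree, forcing \<open>a = b\<close>.\<close>
    have "n * ((a + b) / 2) \<le> n * sqrt (a * b)" using ge sumT mean unfolding eq by simp
    hence "sqrt (a * b) = (a + b) / 2" using amgm n0 by simp
    hence "a * b = ((a + b) / 2)\<^sup>2" using a0 ab by (metis mult_nonneg_nonneg order_trans real_sqrt_pow2)
    hence "(a - b)\<^sup>2 = 0" by (simp add: power2_eq_square field_simps)
    hence beq: "b = a" by simp
    \<comment> \<open>Now the radius is \<open>a\<close>, so the row sums average at most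
      \<open>a\<close>; each is also at least \<open>a\<close>, hence all equal
      \<open>a\<close>.\<close>
    have "(\<Sum>u\<in>?V. T u - a) \<le> 0"
      using ge a0 assms(3) unfolding eq beq by (simp add: sum_subtractf)
    hence "(\<Sum>u\<in>?V. T u - a) = 0" using Ta by (intro antisym sum_nonneg) auto
    hence Teq: "T u = a" if "u \<in> ?V" for u
      using that Ta by (subst (asm) sum_nonneg_eq_0_iff) auto
    have "out_degree G u = max_degree G \<and> (\<forall>v\<in>?V. graph_dist G u v \<le> 2)" if u: "u \<in> ?V" for u
    proof -
      \<comment> \<open>\<open>T u - a\<close> is twice the degree deficit plus twice the excess,
        both nonnegative, so both vanish.\<close>
      have z: "(\<Sum>v\<in>?V. graph_dist G u v - truncated_dist u v) = 0"
        and d: "out_degree G u = max_degree G"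
        using T[OF u] Teq[OF u] excess[OF u] deg_le[OF u] unfolding a_def by auto
      have "graph_dist G u v = truncated_dist u v" if "v \<in> ?V" for v
        using z that graph_dist_truncated(1)[OF u] by (subst (asm) sum_nonneg_eq_0_iff) auto
      with d show ?thesis using graph_dist_truncated(2)[OF u] by blast
    qed
    thus "regular_graph G \<and> graph_diameter G \<le> 2"
      unfolding regular_graph_def graph_diameter_le_iff by blast
  next
    assume R: "regular_graph G \<and> graph_diameter G \<le> 2"
    have deg: "out_degree G u = max_degree G" if "u \<in> ?V" for u
      using R that w unfolding regular_graph_def by auto
    \<comment> \<open>The second maximum degree is attained at some vertex, so regularity makes it
      equal to the maximum.\<close>
    have beq: "b = a" using degs(3) deg unfolding a_def b_def by auto
    have "graph_dist G u v = truncated_dist u v" if "u \<in> ?V" "v \<in> ?V" for u v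
      using R that graph_dist_truncated(2)[OF that] unfolding graph_diameter_le_iff by blast
    hence Teq: "T u = a" if "u \<in> ?V" for u
      using T[OF that] that by (simp add: deg a_def)
    \<comment> \<open>Every absolute row sum is exactly \<open>a\<close>, which matches the lower
      bound since \<open>sqrt (a * a) = a\<close>.\<close>
    have "?\<rho> \<le> a"
      unfolding distance_seidel_radius_def A_def[symmetric]
    proof (rule spectral_radius_le_row_sums[OF _ n0])
      fix i assume i: "i < n"
      have "(\<Sum>j<n. norm (map_mat complex_of_real A $$ (i, j)))
          = (\<Sum>j<n. seidel_weight (vs ! i) (vs ! j))"
        using A i vs seidel_weight_nonneg by (intro sum.cong) (auto simp: ent)
      thus "(\<Sum>j<n. norm (map_mat complex_of_real A $$ (i, j))) \<le> a"
        using row Teq[OF vs[OF i]] by simp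
    qed (use A in simp)
    thus "?\<rho> = sqrt (a * b)" using lower a0 unfolding beq by simp
  qed
  with lower show ?thesis unfolding a_def b_def by blast
qed

end
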